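(* Let $N_1,N_2$ be even positive integers, $N=N_1N_2$, and let $\xi(\bm{s},t)$ be a real-valued advection-diffusion process governed by the PDE $$\dot{\xi}(\bm{s},t)=-\bm{v}^T(\bm{s},t)\nabla\xi(\bm{s},t)+\nabla\cdot[\bm{D}(\bm{s},t)\nabla\xi(\bm{s},t)]+Q(\bm{s},t),$$ treated in its spectral Galerkin representation described in the context. That is, $\xi$ and $Q$ have real Fourier expansions over the wavenumber sets $\mathcal{K}_1,\mathcal{K}_2$ with spectral coefficient vectors $\bm{\alpha}(t),\bm{\beta}(t)\in\mathbb{R}^N$, so that $(\xi(\bm{s}_1,t),\dots,\xi(\bm{s}_N,t))^T=\bm{F}\bm{\alpha}(t)$ on the $N_1\times N_2$ grid, and the coefficients evolve by $\dot{\bm{\alpha}}(t)=\bm{P}(t)\bm{\alpha}(t)+\bm{\beta}(t)$, where $\bm{P}(t)$ is the Galerkin transition matrix defined in the context. Let $\xi^*$ be the flipped process on the $2N_1\times 2N_2$ grid, defined by $$(\xi^*(\bm{s}^*_1,t),\dots,\xi^*(\bm{s}^*_{4N},t))^T=\bm{R}\,(\xi(\bm{s}_1,t),\dots,\xi(\bm{s}_N,t))^T,\qquad \bm{R}=[\bm{I}_{N_2},\bm{J}_{N_2}]^T\otimes[\bm{I}_{N_1},\bm{J}_{N_1}]^T\in\mathbb{R}^{4N\times N}.$$ Let $\bm{F}^*\in\mathbb{R}^{4N\times 4N}$ be the Fourier basis matrix of the flipped grid, and let $\bm{\alpha}^*(t)=(\bm{F}^* )^{\dagger}(\xi^*(\bm{s}^*_1,t),\dots,\xi^*(\bm{s}^*_{4N},t))^T$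 be the vector of spectral coefficients of the flipped process. Then $\bm{\alpha}^*(t)$ satisfies the ordinary differential equation $$\dot{\bm{\alpha}}^*(t)=\bm{H}\bm{P}(t)\bm{H}^{\dagger}\bm{\alpha}^*(t)+\bm{\beta}^*(t),$$ where $\bm{H}=(\bm{F}^* )^{\dagger}\bm{R}\bm{F}$, $\bm{\beta}^*(t)=\bm{H}\bm{\beta}(t)$, and $^{\dagger}$ denotes the Moore-Penrose pseudo-inverse.
   Context: **Matrices.** $\bm{I}_n$ is the $n\times n$ identity matrix and $\bm{J}_n$ is its mirror image, the $n\times n$ matrix with 1s on the anti-diagonal and 0s elsewhere. $[\bm{I}_n,\bm{J}_n]^T$ is the $2n\times n$ matrix obtained by stacking $\bm{I}_n$ on top of $\bm{J}_n$. $\otimes$ is the Kronecker product. A dot denotes $\partial/\partial t$ or $d/dt$. **Grids.** The original grid is $\{(x,y): x\in\{0,1/N_1,\dots,(N_1-1)/N_1\},\ y\in\{0,1/N_2,\dots,(N_2-1)/N_2\}\}$. Its $N$ points $\bm{s}_1,\dots,\bm{s}_N$ are enumerated with the $x$-index varying fastest. The flipped grid is the same construction with $N_1,N_2$ replaced by $2N_1,2N_2$, and its points $\bm{s}^*_1,\dots,\bm{s}^*_{4N}$ are enumerated in the same way. With this enumeration, $\bm{R}$ appends to the image its mirror image in the $x$-direction, and then appends to the result its mirror image in the $y$-direction. **Fourier basis.** For $\bm{k}=(k_1,k_2)^T$ put $f^{(c)}_{\bm{k}}(\bm{s})=\cos(2\pi\bm{k}^T\bm{s})$ and $f^{(s)}_{\bm{k}}(\bm{s})=\sin(2\pi\bm{k}^T\bm{s})$.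 The wavenumber sets are $$\mathcal{K}_1=\{(0,0),(0,N_2/2),(N_1/2,0),(N_1/2,N_2/2)\},$$ $$\begin{aligned}\mathcal{K}_2=\ &\{(k_1,k_2): 1\le k_1\le N_1/2-1,\ -N_2/2+1\le k_2\le -1\}\\ &\cup\{(k_1,k_2): 0\le k_1\le N_1/2,\ 1\le k_2\le N_2/2-1\}\\ &\cup\{(k_1,k_2): 1\le k_1\le N_1/2-1,\ k_2\in\{0,N_2/2\}\},\end{aligned}$$ so that $|\mathcal{K}_1|+2|\mathcal{K}_2|=N$. Fix enumerations $\bm{k}_{1,1},\dots,\bm{k}_{1,|\mathcal{K}_1|}$ of $\mathcal{K}_1$ and $\bm{k}_{2,1},\dots,\bm{k}_{2,|\mathcal{K}_2|}$ of $\mathcal{K}_2$. **Spectral coefficients.** The expansion of $\xi$ is $$\xi(\bm{s},t)=\sum_{\bm{k}\in\mathcal{K}_1}\alpha^{(c)}_{\bm{k}}(t)f^{(c)}_{\bm{k}}(\bm{s})+2\sum_{\bm{k}\in\mathcal{K}_2}\left(\alpha^{(c)}_{\bm{k}}(t)f^{(c)}_{\bm{k}}(\bm{s})+\alpha^{(s)}_{\bm{k}}(t)f^{(s)}_{\bm{k}}(\bm{s})\right),$$ and $Q$ is expanded in the same way with coefficients $\beta^{(c)}_{\bm{k}}(t),\beta^{(s)}_{\bm{k}}(t)$. The vector $\bm{\alpha}(t)\in\mathbb{R}^N$ stacks $(\alpha^{(c)}_{\bm{k}_{1,i}}(t))_i$, then $(\alpha^{(c)}_{\bm{k}_{2,i}}(t))_i$,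 then $(\alpha^{(s)}_{\bm{k}_{2,i}}(t))_i$. The vector $\bm{\beta}(t)$ stacks the coefficients of $Q$ in the same order. **Basis matrices.** $\bm{F}\in\mathbb{R}^{N\times N}$ has $n$-th row $$\left((f^{(c)}_{\bm{k}_{1,i}}(\bm{s}_n))_i,\ (2f^{(c)}_{\bm{k}_{2,i}}(\bm{s}_n))_i,\ (2f^{(s)}_{\bm{k}_{2,i}}(\bm{s}_n))_i\right).$$ $\bm{F}^*\in\mathbb{R}^{4N\times4N}$ is the matrix built in the same way for the flipped grid, with $N_1,N_2$ replaced by $2N_1,2N_2$ in the definitions of $\mathcal{K}_1,\mathcal{K}_2$ and with the points $\bm{s}^*_n$ in place of $\bm{s}_n$. **Transition matrix.** Here $\bm{v}(\bm{s},t)\in\mathbb{R}^2$ is the velocity, $\bm{D}(\bm{s},t)\in\mathbb{R}^{2\times2}$ is the diffusivity, and $Q$ is the forcing term. They are assumed regular enough for the expressions here to make sense. Let $\mathcal{A}g=-\bm{v}^T\nabla g+\nabla\cdot[\bm{D}\nabla g]$, and for functions $g,h$ on $[0,1]^2$ let $\langle g,h\rangle=\int_{[0,1]^2}g\,h\,d\bm{s}$. For $a,b\in\{1,2\}$ define matrices $\bm{\Psi}^{(m)}_{ab}$ of size $|\mathcal{K}_a|\times|\mathcal{K}_b|$ whose $(i,j)$ entries are, with $\bm{k}=\bm{k}_{b,j}$ and $\bm{k}'=\bm{k}_{a,i}$: - $m=\text{A1+D1}$: $\langle\mathcal{A}f^{(c)}_{\bm{k}},f^{(c)}_{\bm{k}'}\rangle$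 - $m=\text{A2+D2}$: $\langle\mathcal{A}f^{(s)}_{\bm{k}},f^{(c)}_{\bm{k}'}\rangle$ - $m=\text{A3+D3}$: $\langle\mathcal{A}f^{(c)}_{\bm{k}},f^{(s)}_{\bm{k}'}\rangle$ - $m=\text{A4+D4}$: $\langle\mathcal{A}f^{(s)}_{\bm{k}},f^{(s)}_{\bm{k}'}\rangle$ Let $\bm{C}_a=\mathrm{diag}(c_{\bm{k}_{a,1}},\dots,c_{\bm{k}_{a,|\mathcal{K}_a|}})$ with $c_{\bm{k}}=\int_{[0,1]^2}\cos^2(2\pi\bm{k}^T\bm{s})\,d\bm{s}$. Then $$\bm{P}(t)=\begin{pmatrix}\bm{C}_1^{-1}\bm{\Psi}^{(\text{A1+D1})}_{11}&2\bm{C}_1^{-1}\bm{\Psi}^{(\text{A1+D1})}_{12}&2\bm{C}_1^{-1}\bm{\Psi}^{(\text{A2+D2})}_{12}\\ \tfrac12\bm{C}_2^{-1}\bm{\Psi}^{(\text{A1+D1})}_{21}&\bm{C}_2^{-1}\bm{\Psi}^{(\text{A1+D1})}_{22}&\bm{C}_2^{-1}\bm{\Psi}^{(\text{A2+D2})}_{22}\\ \tfrac12\bm{C}_2^{-1}\bm{\Psi}^{(\text{A3+D3})}_{21}&\bm{C}_2^{-1}\bm{\Psi}^{(\text{A3+D3})}_{22}&\bm{C}_2^{-1}\bm{\Psi}^{(\text{A4+D4})}_{22}\end{pmatrix}\in\mathbb{R}^{N\times N}.$$ **Convention.** "Governed by the PDE" is understood in the Galerkin sense: the coefficient vector of $\xi$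 satisfies $\dot{\bm{\alpha}}(t)=\bm{P}(t)\bm{\alpha}(t)+\bm{\beta}(t)$ (without noise terms). No truncation of the coefficient vectors is applied. *)

theory Defs
  imports
    "HOL-Analysis.Analysis"
    "Jordan_Normal_Form.Gauss_Jordan_Elimination"
begin

(* Grid-sized objects, whose dimensions depend on N1 and N2, are Jordan_Normal_Form vectors and
   matrices (0-based indices); points, velocities and diffusivities live in real^2 and real^2^2.
   The notation $ is reserved for the former, so components in real^2 are written with vec_nth. *)

unbundle no vec_syntax
unbundle no inner_syntax

definition is_mp_inverse :: "real mat \<Rightarrow> real mat \<Rightarrow> bool" where
  "is_mp_inverse A X \<longleftrightarrow>
     X \<in> carrier_mat (dim_col A) (dim_row A) \<and>
     A * X * A = A \<and> X * A * X = X \<and>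
     transpose_mat (A * X) = A * X \<and> transpose_mat (X * A) = X * A"

lemma is_mp_inverse_unique:
  assumes X: "is_mp_inverse A X" and Y: "is_mp_inverse A Y"
  shows "X = Y"
proof -
  obtain m n where A: "A \<in> carrier_mat m n" by auto
  have Xc: "X \<in> carrier_mat n m" and Yc: "Y \<in> carrier_mat n m"
    using X Y A unfolding is_mp_inverse_def by auto
  have AXA: "A * X * A = A" and XAX: "X * A * X = X"
    and AX: "transpose_mat (A * X) = A * X" and XA: "transpose_mat (X * A) = X * A"
    and AYA: "A * Y * A = A" and YAY: "Y * A * Y = Y"
    and AY: "transpose_mat (A * Y) = A * Y" and YA: "transpose_mat (Y * A) = Y * A"
    using X Y unfolding is_mp_inverse_def by auto
  have AXc: "A * X \<in> carrier_mat m m" and AYc: "A * Y \<in> carrier_mat m m"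
    and XAc: "X * A \<in> carrier_mat n n" and YAc: "Y * A \<in> carrier_mat n n"
    using A Xc Yc by auto
  have 1: "(A * Y) * (A * X) = A * X"
    using assoc_mult_mat[OF AYc A Xc] AYA by simp
  have 2: "(A * X) * (A * Y) = A * Y"
    using assoc_mult_mat[OF AXc A Yc] AXA by simp
  have AXY: "A * X = A * Y"
    using arg_cong[OF 1, of transpose_mat] transpose_mult[OF AYc AXc] AX AY 2 by simp
  have 3: "(X * A) * (Y * A) = X * A"
    using assoc_mult_mat[OF Xc A YAc] assoc_mult_mat[OF A Yc A] AYA by simp
  have 4: "(Y * A) * (X * A) = Y * A"
    using assoc_mult_mat[OF Yc A XAc] assoc_mult_mat[OF A Xc A] AXA by simp
  have XAY: "X * A = Y * A"
    using arg_cong[OF 3, of transpose_mat] transpose_mult[OF XAc YAc] XA YA 4 by simp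
  have "X = Y * A * X" using XAX XAY by simp
  also have "\<dots> = Y * (A * X)" by (rule assoc_mult_mat[OF Yc A Xc])
  also have "\<dots> = Y * (A * Y)" using AXY by simp
  also have "\<dots> = Y" using assoc_mult_mat[OF Yc A Yc] YAY by simp
  finally show ?thesis .
qed

definition mp_inverse :: "real mat \<Rightarrow> real mat" where
  "mp_inverse A = (THE X. is_mp_inverse A X)"

definition kronecker :: "real mat \<Rightarrow> real mat \<Rightarrow> real mat" where
  "kronecker A B = mat (dim_row A * dim_row B) (dim_col A * dim_col B)
     (\<lambda>(i, j). A $$ (i div dim_row B, j div dim_col B) * B $$ (i mod dim_row B, j mod dim_col B))"

definition mirror_mat :: "nat \<Rightarrow> real mat" where
  "mirror_mat n = mat n n (\<lambda>(i, j). if i + j + 1 = n then 1 else 0)"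

definition append_cols :: "real mat \<Rightarrow> real mat \<Rightarrow> real mat" (infixr \<open>@\<^sub>c\<close> 66) where
  "A @\<^sub>c B = four_block_mat A B (0\<^sub>m 0 (dim_col A)) (0\<^sub>m 0 (dim_col B))"

(* The type of vectors carries no topology; as the dimension is finite, differentiation is
   componentwise. *)
definition vec_has_deriv :: "(real \<Rightarrow> real vec) \<Rightarrow> real vec \<Rightarrow> real \<Rightarrow> real set \<Rightarrow> bool" where
  "vec_has_deriv x d t T \<longleftrightarrow>
     (\<forall>\<tau>\<in>T. dim_vec (x \<tau>) = dim_vec d) \<and>
     (\<forall>i<dim_vec d. ((\<lambda>\<tau>. x \<tau> $ i) has_real_derivative d $ i) (at t within T))"

definition grid_point :: "nat \<Rightarrow> nat \<Rightarrow> nat \<Rightarrow> real^2" where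
  "grid_point N1 N2 n = vector [real (n mod N1) / real N1, real (n div N1) / real N2]"

definition grid_values :: "nat \<Rightarrow> nat \<Rightarrow> (real^2 \<Rightarrow> real) \<Rightarrow> real vec" where
  "grid_values N1 N2 g = vec (N1 * N2) (\<lambda>n. g (grid_point N1 N2 n))"

definition flip_mat :: "nat \<Rightarrow> nat \<Rightarrow> real mat" where
  "flip_mat N1 N2 = kronecker (1\<^sub>m N2 @\<^sub>r mirror_mat N2) (1\<^sub>m N1 @\<^sub>r mirror_mat N1)"

type_synonym wavenumber = "int \<times> int"

definition phase :: "wavenumber \<Rightarrow> real^2 \<Rightarrow> real" where
  "phase k s = 2 * pi * (of_int (fst k) * vec_nth s 1 + of_int (snd k) * vec_nth s 2)"

definition fc :: "wavenumber \<Rightarrow> real^2 \<Rightarrow> real" where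
  "fc k s = cos (phase k s)"

definition fs :: "wavenumber \<Rightarrow> real^2 \<Rightarrow> real" where
  "fs k s = sin (phase k s)"

(* Used for even N1, N2 only, where div is exact. *)
definition K1 :: "nat \<Rightarrow> nat \<Rightarrow> wavenumber set" where
  "K1 N1 N2 = (let h1 = int N1 div 2; h2 = int N2 div 2 in
     {(0, 0), (0, h2), (h1, 0), (h1, h2)})"

definition K2 :: "nat \<Rightarrow> nat \<Rightarrow> wavenumber set" where
  "K2 N1 N2 = (let h1 = int N1 div 2; h2 = int N2 div 2 in
     {1..h1 - 1} \<times> {- h2 + 1..- 1} \<union>
     {0..h1} \<times> {1..h2 - 1} \<union>
     {1..h1 - 1} \<times> {0, h2})"

definition enumerates :: "'a list \<Rightarrow> 'a set \<Rightarrow> bool" where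
  "enumerates ks K \<longleftrightarrow> distinct ks \<and> set ks = K"

definition fourier_expansion ::
    "nat \<Rightarrow> nat \<Rightarrow> (wavenumber \<Rightarrow> real) \<Rightarrow> (wavenumber \<Rightarrow> real) \<Rightarrow> real^2 \<Rightarrow> real" where
  "fourier_expansion N1 N2 a b s =
     (\<Sum>k\<in>K1 N1 N2. a k * fc k s) + 2 * (\<Sum>k\<in>K2 N1 N2. a k * fc k s + b k * fs k s)"

definition coeff_vec ::
    "wavenumber list \<Rightarrow> wavenumber list \<Rightarrow> (wavenumber \<Rightarrow> real) \<Rightarrow> (wavenumber \<Rightarrow> real) \<Rightarrow> real vec" where
  "coeff_vec ks1 ks2 a b = vec_of_list (map a ks1 @ map a ks2 @ map b ks2)"

definition fourier_mat ::
    "nat \<Rightarrow> nat \<Rightarrow> wavenumber list \<Rightarrow> wavenumber list \<Rightarrow> real mat" where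
  "fourier_mat N1 N2 ks1 ks2 = mat_of_rows (N1 * N2)
     (map (\<lambda>n. let s = grid_point N1 N2 n in
        vec_of_list (map (\<lambda>k. fc k s) ks1 @ map (\<lambda>k. 2 * fc k s) ks2 @ map (\<lambda>k. 2 * fs k s) ks2))
      [0..<N1 * N2])"

(* From here on v and D are the velocity and diffusivity fields at a fixed time. *)

definition gradient :: "(real^2 \<Rightarrow> real) \<Rightarrow> real^2 \<Rightarrow> real^2" where
  "gradient g s = vec_lambda (\<lambda>i. frechet_derivative g (at s) (axis i 1))"

definition divergence :: "(real^2 \<Rightarrow> real^2) \<Rightarrow> real^2 \<Rightarrow> real" where
  "divergence G s = (\<Sum>i\<in>UNIV. vec_nth (frechet_derivative G (at s) (axis i 1)) i)"

definition adv_diff ::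
    "(real^2 \<Rightarrow> real^2) \<Rightarrow> (real^2 \<Rightarrow> real^2^2) \<Rightarrow> (real^2 \<Rightarrow> real) \<Rightarrow> real^2 \<Rightarrow> real" where
  "adv_diff v D g s = - inner (v s) (gradient g s) + divergence (\<lambda>r. D r *v gradient g r) s"

definition inner_sq :: "(real^2 \<Rightarrow> real) \<Rightarrow> (real^2 \<Rightarrow> real) \<Rightarrow> real" where
  "inner_sq g h = integral (cbox 0 1) (\<lambda>s. g s * h s)"

(* The regularity under which the entries of the Galerkin matrices make sense: D is differentiable
   in the open unit square (the boundary is a null set) and the integrands are integrable. *)
definition regular_fields ::
    "nat \<Rightarrow> nat \<Rightarrow> (real^2 \<Rightarrow> real^2) \<Rightarrow> (real^2 \<Rightarrow> real^2^2) \<Rightarrow> bool" where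
  "regular_fields N1 N2 v D \<longleftrightarrow>
     (\<forall>s\<in>box 0 1. D differentiable (at s)) \<and>
     (\<forall>f\<in>{fc, fs}. \<forall>f'\<in>{fc, fs}. \<forall>k\<in>K1 N1 N2 \<union> K2 N1 N2. \<forall>k'\<in>K1 N1 N2 \<union> K2 N1 N2.
        (\<lambda>s. adv_diff v D (f k) s * f' k' s) absolutely_integrable_on cbox 0 1)"

(* psi_mat v D f f' ks ks' has rows indexed by the test functions f' k' (k' in ks') and columns by
   the trial functions f k (k in ks). The types (A1+D1), ..., (A4+D4) are
   (f, f') = (fc, fc), (fs, fc), (fc, fs), (fs, fs). *)
definition psi_mat ::
    "(real^2 \<Rightarrow> real^2) \<Rightarrow> (real^2 \<Rightarrow> real^2^2) \<Rightarrow>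
     (wavenumber \<Rightarrow> real^2 \<Rightarrow> real) \<Rightarrow> (wavenumber \<Rightarrow> real^2 \<Rightarrow> real) \<Rightarrow>
     wavenumber list \<Rightarrow> wavenumber list \<Rightarrow> real mat" where
  "psi_mat v D f f' ks ks' = mat (length ks') (length ks)
     (\<lambda>(i, j). inner_sq (adv_diff v D (f (ks ! j))) (f' (ks' ! i)))"

definition norm_mat :: "wavenumber list \<Rightarrow> real mat" where
  "norm_mat ks = mat_diag (length ks)
     (\<lambda>i. integral (cbox 0 1) (\<lambda>s. (cos (phase (ks ! i) s))\<^sup>2))"

definition galerkin_mat ::
    "(real^2 \<Rightarrow> real^2) \<Rightarrow> (real^2 \<Rightarrow> real^2^2) \<Rightarrow> wavenumber list \<Rightarrow> wavenumber list \<Rightarrow> real mat" where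
  "galerkin_mat v D ks1 ks2 =
     (let C1i = the (mat_inverse (norm_mat ks1)); C2i = the (mat_inverse (norm_mat ks2)) in
       (C1i * psi_mat v D fc fc ks1 ks1
          @\<^sub>c 2 \<cdot>\<^sub>m (C1i * psi_mat v D fc fc ks2 ks1)
          @\<^sub>c 2 \<cdot>\<^sub>m (C1i * psi_mat v D fs fc ks2 ks1))
       @\<^sub>r
       ((1/2) \<cdot>\<^sub>m (C2i * psi_mat v D fc fc ks1 ks2)
          @\<^sub>c C2i * psi_mat v D fc fc ks2 ks2
          @\<^sub>c C2i * psi_mat v D fs fc ks2 ks2)
       @\<^sub>r
       ((1/2) \<cdot>\<^sub>m (C2i * psi_mat v D fc fs ks1 ks2)
          @\<^sub>c C2i * psi_mat v D fc fs ks2 ks2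
          @\<^sub>c C2i * psi_mat v D fs fs ks2 ks2))"

end

(* The real Fourier basis is orthogonal on the grid, because modulo the grid size no two distinct
   wavenumbers of K1 and K2 are congruent up to sign, and none in K2 is congruent to its own
   negative; so F and Fs are invertible. Since R contains the identity, it is injective, and hence
   so is H = Fs^+ R F. On T the flipped coefficients are H alpha, and full column rank gives
   H^+ H = I, so that applying H to the equation of alpha yields H P alpha = H P H^+ (H alpha). *)
theory Submission
  imports Defs "Jordan_Normal_Form.Determinant" "HOL-Library.Real_Mod"
begin

section \<open>Pseudo-inverses of matrices with full column rank\<close>

text \<open>The squared length of \<open>A x\<close> is the pairing of \<open>A^T A x\<close> with
  \<open>x\<close>, hence zero.\<close>

lemma kernel_transpose_mult_self:
  fixes A :: "real mat"
  assumes A: "A \<in> carrier_mat m n" and x: "x \<in> carrier_vec n"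
    and 0: "(transpose_mat A * A) *\<^sub>v x = 0\<^sub>v n"
  shows "A *\<^sub>v x = 0\<^sub>v m"
proof -
  have Ax: "A *\<^sub>v x \<in> carrier_vec m" using A x by auto
  have "(A *\<^sub>v x) \<bullet> (A *\<^sub>v x) = (transpose_mat A *\<^sub>v (A *\<^sub>v x)) \<bullet> x"
    using transpose_vec_mult_scalar[OF A x Ax] by simp
  also have "transpose_mat A *\<^sub>v (A *\<^sub>v x) = 0\<^sub>v n"
    using 0 assoc_mult_mat_vec[of "transpose_mat A" n m A n x] A x by simp
  finally have "(A *\<^sub>v x) \<bullet> (A *\<^sub>v x) = 0" using x by simp
  \<comment> \<open>Over the reals conjugation is trivial, so definiteness of the conjugate scalar
    product applies.\<close>
  moreover have "conjugate (A *\<^sub>v x) = A *\<^sub>v x" by (intro eq_vecI) auto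
  ultimately show ?thesis using conjugate_square_eq_0_vec[OF Ax] by simp
qed

text \<open>Injectivity of \<open>A\<close> makes the Gram matrix \<open>A^T A\<close> invertible,
  and the witness is the least-squares inverse \<open>(A^T A)^-1 A^T\<close>.\<close>

lemma is_mp_inverse_full_col_rank:
  assumes A: "A \<in> carrier_mat m n"
    and inj: "\<And>x. x \<in> carrier_vec n \<Longrightarrow> A *\<^sub>v x = 0\<^sub>v m \<Longrightarrow> x = 0\<^sub>v n"
  shows "\<exists>X. is_mp_inverse A X \<and> X * A = 1\<^sub>m n"
proof -
  let ?At = "transpose_mat A" and ?G = "transpose_mat A * A"
  have At: "?At \<in> carrier_mat n m" and G: "?G \<in> carrier_mat n n" using A by auto
  have "Determinant.det ?G \<noteq> 0"
    using det_0_iff_vec_prod_zero_field[OF G] kernel_transpose_mult_self[OF A] inj by blast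
  from det_non_zero_imp_unit[OF G this, of "()"]
  obtain B where B: "B \<in> carrier_mat n n" and BG: "B * ?G = 1\<^sub>m n" and GB: "?G * B = 1\<^sub>m n"
    unfolding Units_def ring_mat_def by auto
  have Gt: "transpose_mat ?G = ?G" using transpose_mult[OF At A] by simp
  have Bt: "transpose_mat B \<in> carrier_mat n n" using B by simp
  have BtG: "transpose_mat B * ?G = 1\<^sub>m n"
    using arg_cong[OF GB, of transpose_mat] transpose_mult[OF G B] Gt by simp
  \<comment> \<open>As the Gram matrix is symmetric, the transpose of its inverse \<open>B\<close>
    is again a left inverse and so equals \<open>B\<close>. This symmetry is what makes
    \<open>A * X\<close> symmetric below.\<close>
  have "transpose_mat B = transpose_mat B * (?G * B)" using GB Bt by simp
  also have "\<dots> = B" using assoc_mult_mat[OF Bt G B] BtG B by simp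
  finally have Bsym: "transpose_mat B = B" .
  define X where "X = B * ?At"
  have X: "X \<in> carrier_mat n m" using B At unfolding X_def by simp
  have XA: "X * A = 1\<^sub>m n" unfolding X_def using assoc_mult_mat[OF B At A] BG by simp
  have AXA: "A * X * A = A" using assoc_mult_mat[OF A X A] XA A by simp
  have XAX: "X * A * X = X" using XA X by simp
  have Xt: "transpose_mat X = A * B" unfolding X_def using transpose_mult[OF B At] Bsym by simp
  have "transpose_mat (A * X) = transpose_mat X * ?At" by (rule transpose_mult[OF A X])
  also have "\<dots> = A * X" using Xt X_def assoc_mult_mat[OF A B At] by simp
  finally have "is_mp_inverse A X"
    unfolding is_mp_inverse_def using AXA XAX X A XA by auto
  then show ?thesis using XA by blast
qed

text \<open>By uniqueness, the definite description denotes the explicit inverse found above.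
  Dimensions and left inversion are all that the flipped system uses of it.\<close>

lemma mp_inverse_full_col_rank:
  assumes A: "A \<in> carrier_mat m n"
    and inj: "\<And>x. x \<in> carrier_vec n \<Longrightarrow> A *\<^sub>v x = 0\<^sub>v m \<Longrightarrow> x = 0\<^sub>v n"
  shows "mp_inverse A \<in> carrier_mat n m" "mp_inverse A * A = 1\<^sub>m n"
proof -
  obtain X where X: "is_mp_inverse A X" "X * A = 1\<^sub>m n"
    using is_mp_inverse_full_col_rank[OF assms] by blast
  then have "mp_inverse A = X"
    unfolding mp_inverse_def using is_mp_inverse_unique by (intro the_equality) auto
  then show "mp_inverse A \<in> carrier_mat n m" "mp_inverse A * A = 1\<^sub>m n"
    using X A unfolding is_mp_inverse_def by auto
qed

section \<open>Dimensions of the Galerkin system\<close>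

text \<open>A right inverse of a square matrix over a field is two-sided, so \<open>A\<close> is a
  unit and \<open>mat_inverse\<close> cannot return \<open>None\<close>.\<close>

lemma mat_inverse_carrier:
  fixes A :: "'a :: field mat"
  assumes A: "A \<in> carrier_mat n n" and B: "B \<in> carrier_mat n n"
    and AB: "A * B = 1\<^sub>m n"
  shows "the (mat_inverse A) \<in> carrier_mat n n"
proof -
  have "A \<in> Units (ring_mat TYPE('a) n ())"
    using A B AB mat_mult_left_right_inverse[OF A B AB] unfolding Units_def ring_mat_def by auto
  then obtain C where "mat_inverse A = Some C"
    using mat_inverse(1)[OF A, of "()"] by (cases "mat_inverse A") auto
  then show ?thesis using mat_inverse(2)[OF A] by auto
qed

text \<open>\<^const>\<open>mat_inverse\<close> returns \<^const>\<open>None\<close> on a singular matrix, so even the dimensions of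
  the transition matrix depend on the norming matrices being invertible.\<close>

lemma norm_mat_inverse_carrier:
  "the (mat_inverse (norm_mat ks)) \<in> carrier_mat (length ks) (length ks)"
proof -
  define c where "c i = integral (cbox 0 1) (\<lambda>s::real^2. (cos (phase (ks ! i) s))\<^sup>2)" for i
  \<comment> \<open>The integrand is continuous and nonnegative, so a zero integral would make it
    vanish on the whole square; but it is 1 at the origin.\<close>
  have c: "c i \<noteq> 0" for i
  proof
    assume "c i = 0"
    moreover have "continuous_on (cbox 0 (1::real^2)) (\<lambda>s. (cos (phase (ks ! i) s))\<^sup>2)"
      unfolding phase_def by (intro continuous_intros)
    moreover have "box 0 (1::real^2) \<noteq> {}"
      unfolding box_ne_empty by (auto simp: Basis_vec_def inner_axis)
    moreover have "0 \<in> cbox 0 (1::real^2)" by (simp add: mem_box_cart)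
    ultimately have "(cos (phase (ks ! i) 0))\<^sup>2 = 0"
      unfolding c_def by (subst (asm) integral_cbox_eq_0_iff) auto
    then show False by (simp add: phase_def)
  qed
  have "norm_mat ks * mat_diag (length ks) (\<lambda>i. 1 / c i) = 1\<^sub>m (length ks)"
    unfolding norm_mat_def c_def[symmetric] mat_diag_diag using c by simp
  then show ?thesis
    by (intro mat_inverse_carrier[where B = "mat_diag (length ks) (\<lambda>i. 1 / c i)"])
       (auto simp: norm_mat_def)
qed

lemma galerkin_mat_carrier:
  "galerkin_mat v D ks1 ks2 \<in>
    carrier_mat (length ks1 + 2 * length ks2) (length ks1 + 2 * length ks2)"
  using norm_mat_inverse_carrier[of ks1] norm_mat_inverse_carrier[of ks2]
  by (auto simp: galerkin_mat_def Let_def append_cols_def append_rows_def psi_mat_def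
      intro!: carrier_matI)

section \<open>Counting the wavenumbers\<close>

lemma card_K1:
  assumes "N1 > 0" "even N1" "N2 > 0" "even N2"
  shows "card (K1 N1 N2) = 4"
proof -
  have "int N1 div 2 \<noteq> 0" "int N2 div 2 \<noteq> 0" using assms by presburger+
  then show ?thesis by (simp add: K1_def Let_def)
qed

text \<open>With \<open>N1 = 2 * h1\<close> and \<open>N2 = 2 * h2\<close>, the three disjoint
  blocks of \<open>K2\<close> have \<open>(h1 - 1) * (h2 - 1)\<close>,
  \<open>(h1 + 1) * (h2 - 1)\<close> and \<open>2 * (h1 - 1)\<close> elements, in total
  \<open>2 * h1 * h2 - 2\<close>.\<close>

lemma card_K2:
  assumes "N1 > 0" "even N1" "N2 > 0" "even N2"
  shows "4 + 2 * card (K2 N1 N2) = N1 * N2"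
proof -
  obtain h1 h2 where h: "N1 = 2 * h1" "N2 = 2 * h2" "h1 > 0" "h2 > 0"
    using assms by (auto elim!: evenE)
  have "card (K2 N1 N2) = card ({1..int h1 - 1} \<times> {- int h2 + 1..- 1} \<union>
     {0..int h1} \<times> {1..int h2 - 1}) + card ({1..int h1 - 1} \<times> {0, int h2})"
    unfolding K2_def Let_def h using h by (subst card_Un_disjoint) auto
  also have "\<dots> = (h1 - 1) * (h2 - 1) + (h1 + 1) * (h2 - 1) + (h1 - 1) * 2"
    using h by (subst card_Un_disjoint) (auto simp: card_cartesian_product nat_diff_distrib nat_add_distrib)
  finally have "card (K2 N1 N2) = \<dots>" .
  \<comment> \<open>Writing both halves as successors removes the truncated subtractions.\<close>
  moreover obtain a b where "h1 = Suc a" "h2 = Suc b" using h by (auto simp: gr0_conv_Suc)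
  ultimately show ?thesis by (simp add: h algebra_simps)
qed

lemma finite_K: "finite (K1 N1 N2)" "finite (K2 N1 N2)"
  by (auto simp: K1_def K2_def Let_def)

lemma disjoint_K: "K1 N1 N2 \<inter> K2 N1 N2 = {}"
  by (auto simp: K1_def K2_def Let_def)

text \<open>This count makes the rows of \<open>fourier_mat\<close> as long as the grid is large, so
  that the matrix is square.\<close>

lemma length_enumerations:
  assumes "N1 > 0" "even N1" "N2 > 0" "even N2"
    and "enumerates ks1 (K1 N1 N2)" "enumerates ks2 (K2 N1 N2)"
  shows "length ks1 + 2 * length ks2 = N1 * N2"
  using assms card_K1[of N1 N2] card_K2[of N1 N2]
  by (auto simp: enumerates_def distinct_card[symmetric])

section \<open>Discrete orthogonality of the real Fourier basis\<close>

text \<open>First components lie in \<open>[0, h1]\<close> and second ones in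
  \<open>(-h2, h2]\<close>, so differences are too small to be nonzero multiples of the grid sizes.
  A sum of first components divisible by \<open>N1\<close> forces both to be 0 or both to be
  \<open>h1\<close>; there the second components are nonnegative, and the same argument applies to
  them.\<close>

lemma K_cong:
  assumes N: "N1 > 0" "even N1" "N2 > 0" "even N2"
    and k: "k \<in> K1 N1 N2 \<union> K2 N1 N2" and l: "l \<in> K1 N1 N2 \<union> K2 N1 N2"
  shows "int N1 dvd fst k - fst l \<and> int N2 dvd snd k - snd l \<longleftrightarrow> k = l"
    and "int N1 dvd fst k + fst l \<and> int N2 dvd snd k + snd l \<longleftrightarrow> k = l \<and> k \<in> K1 N1 N2"
proof -
  obtain h1 h2 where h: "N1 = 2 * h1" "N2 = 2 * h2" "h1 > 0" "h2 > 0"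
    using N by (auto elim!: evenE)
  have K1: "p \<in> K1 N1 N2 \<longleftrightarrow> (fst p = 0 \<or> fst p = int h1) \<and> (snd p = 0 \<or> snd p = int h2)" for p
    by (cases p) (auto simp: K1_def Let_def h)
  have bounds: "0 \<le> fst p" "fst p \<le> int h1" "- int h2 < snd p" "snd p \<le> int h2"
      "fst p = 0 \<or> fst p = int h1 \<Longrightarrow> 0 \<le> snd p" if "p \<in> K1 N1 N2 \<union> K2 N1 N2" for p
    using that h by (cases p; auto simp: K1_def K2_def Let_def)+
  note kb = bounds[OF k] and lb = bounds[OF l]
  \<comment> \<open>The half-open window \<open>(-n, n]\<close> contains only the multiples 0 and
    \<open>n\<close>.\<close>
  have dvd: "d = 0 \<or> d = n" if "n dvd d" "- n < d" "d \<le> n" for d n :: int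
    using that zdvd_imp_le[of n d] zdvd_imp_le[of n "- d"] by (cases d "0::int" rule: linorder_cases) auto
  have N': "int N1 = 2 * int h1" "int N2 = 2 * int h2" "0 < int h1" "0 < int h2"
    using h by auto
  show "int N1 dvd fst k - fst l \<and> int N2 dvd snd k - snd l \<longleftrightarrow> k = l" (is "?L \<longleftrightarrow> ?R")
  proof
    assume L: ?L
    have "fst k - fst l = 0 \<or> fst k - fst l = int N1"
    proof (rule dvd)
      show "- int N1 < fst k - fst l" "fst k - fst l \<le> int N1"
        using kb(1,2) lb(1,2) N' by linarith+
    qed (use L in blast)
    then have 1: "fst k = fst l" using kb(1,2) lb(1,2) N' by linarith
    have "snd k - snd l = 0 \<or> snd k - snd l = int N2"
    proof (rule dvd)
      show "- int N2 < snd k - snd l" "snd k - snd l \<le> int N2"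
        using kb(3,4) lb(3,4) N' by linarith+
    qed (use L in blast)
    then have "snd k = snd l" using kb(3,4) lb(3,4) N' by linarith
    with 1 show ?R by (rule prod_eqI)
  qed auto
  show "int N1 dvd fst k + fst l \<and> int N2 dvd snd k + snd l \<longleftrightarrow> k = l \<and> k \<in> K1 N1 N2" (is "?L \<longleftrightarrow> ?R")
  proof
    assume L: ?L
    have "fst k + fst l = 0 \<or> fst k + fst l = int N1"
    proof (rule dvd)
      show "- int N1 < fst k + fst l" "fst k + fst l \<le> int N1"
        using kb(1,2) lb(1,2) N' by linarith+
    qed (use L in blast)
    then have 1: "fst k = fst l" "fst k = 0 \<or> fst k = int h1"
      using kb(1,2) lb(1,2) N' by linarith+
    then have pos: "0 \<le> snd k" "0 \<le> snd l" using kb(5) lb(5) by auto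
    have "snd k + snd l = 0 \<or> snd k + snd l = int N2"
    proof (rule dvd)
      show "- int N2 < snd k + snd l" "snd k + snd l \<le> int N2"
        using kb(3,4) lb(3,4) N' by linarith+
    qed (use L in blast)
    then have "snd k = snd l" "snd k = 0 \<or> snd k = int h2"
      using pos kb(4) lb(4) N' by linarith+
    with 1 show ?R unfolding K1 by (auto intro: prod_eqI)
  next
    assume ?R
    then have "k = l" "fst l = 0 \<or> fst l = int h1" "snd l = 0 \<or> snd l = int h2"
      unfolding K1 by auto
    then show ?L unfolding N' by auto
  qed
qed

text \<open>A geometric sum whose ratio \<open>w\<close> satisfies \<open>w^n = 1\<close>: it
  vanishes unless \<open>w = 1\<close>, which happens exactly when \<open>n\<close> divides
  \<open>m\<close>.\<close>

lemma sum_root_of_unity_powers: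
  assumes "n > 0"
  shows "(\<Sum>j<n. cis (2 * pi * (of_int m / of_nat n)) ^ j) = (if int n dvd m then of_nat n else 0)"
proof (cases "int n dvd m")
  case True
  then obtain c where "m = int n * c" by (auto elim: dvdE)
  then have "2 * pi * (of_int m / of_nat n) = 2 * pi * of_int c" using assms by simp
  then have "cis (2 * pi * (of_int m / of_nat n)) = 1" by (simp only: cis_multiple_2pi Ints_of_int)
  then show ?thesis using True by simp
next
  case False
  let ?w = "cis (2 * pi * (of_int m / of_nat n))"
  have "?w \<noteq> 1"
  proof
    assume "?w = 1"
    then obtain c :: int where "2 * pi * (of_int m / of_nat n) = of_int c * (2 * pi)"
      unfolding cis_eq_1_iff by blast
    then have "real_of_int m = of_int (int n * c)" using assms by (simp add: field_simps)
    then show False using False unfolding of_int_eq_iff by simp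
  qed
  moreover have "?w ^ n = cis (2 * pi * of_int m)" using assms by (simp add: Complex.DeMoivre field_simps)
  then have "?w ^ n = 1" by (simp only: cis_multiple_2pi Ints_of_int)
  ultimately show ?thesis using False by (simp add: geometric_sum)
qed

text \<open>The point with index \<open>j + i * N1\<close> is \<open>(j / N1, i / N2)\<close>, so
  the exponential factors over the coordinates and the sum is a product of two geometric
  sums.\<close>

lemma sum_cis_grid:
  assumes "N1 > 0" "N2 > 0"
  shows "(\<Sum>n<N1 * N2. cis (phase m (grid_point N1 N2 n))) =
    (if int N1 dvd fst m \<and> int N2 dvd snd m then of_nat (N1 * N2) else 0)"
proof -
  let ?w1 = "cis (2 * pi * (of_int (fst m) / of_nat N1))"
  let ?w2 = "cis (2 * pi * (of_int (snd m) / of_nat N2))"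
  have "cis (phase m (grid_point N1 N2 (j + i * N1))) = ?w2 ^ i * ?w1 ^ j" if "j < N1" for i j
    using that assms
    by (simp add: phase_def grid_point_def Complex.DeMoivre cis_mult algebra_simps)
  then have "(\<Sum>n<N1 * N2. cis (phase m (grid_point N1 N2 n))) = (\<Sum>i<N2. \<Sum>j<N1. ?w2 ^ i * ?w1 ^ j)"
    unfolding mult.commute[of N1] sum_mult_product by (intro sum.cong) auto
  also have "\<dots> = (\<Sum>i<N2. ?w2 ^ i) * (\<Sum>j<N1. ?w1 ^ j)" by (simp add: sum_product)
  finally show ?thesis
    unfolding sum_root_of_unity_powers[OF assms(1)] sum_root_of_unity_powers[OF assms(2)] by simp
qed

lemma sum_fc_grid:
  assumes "N1 > 0" "N2 > 0"
  shows "(\<Sum>n<N1 * N2. fc m (grid_point N1 N2 n)) =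
    (if int N1 dvd fst m \<and> int N2 dvd snd m then real (N1 * N2) else 0)"
  using arg_cong[OF sum_cis_grid[OF assms, of m], of Re] by (auto simp: fc_def split: if_splits)

lemma sum_fs_grid:
  assumes "N1 > 0" "N2 > 0"
  shows "(\<Sum>n<N1 * N2. fs m (grid_point N1 N2 n)) = 0"
  using arg_cong[OF sum_cis_grid[OF assms, of m], of Im] by (auto simp: fs_def split: if_splits)

lemma phase_add_diff: "phase (k + l) s = phase k s + phase l s" "phase (k - l) s = phase k s - phase l s"
  by (simp_all add: phase_def algebra_simps)

text \<open>These reduce grid inner products to the sums above at the wavenumbers
  \<open>k - l\<close> and \<open>k + l\<close>.\<close>

lemma fc_fs_products:
  "fc k s * fc l s = (fc (k - l) s + fc (k + l) s) / 2"
  "fs k s * fs l s = (fc (k - l) s - fc (k + l) s) / 2"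
  "fs k s * fc l s = (fs (k + l) s + fs (k - l) s) / 2"
  by (simp_all add: fc_def fs_def phase_add_diff cos_times_cos sin_times_sin sin_times_cos)

text \<open>By \<open>K_cong\<close> the term at \<open>k - l\<close> survives only for
  \<open>k = l\<close>, and the one at \<open>k + l\<close> only for \<open>k = l\<close> in
  \<open>K1\<close>. On \<open>K1\<close> the two terms add up for cosines and cancel for sines; on
  \<open>K2\<close> only the first remains, which halves the norm.\<close>

lemma fourier_orthogonality:
  assumes N: "N1 > 0" "even N1" "N2 > 0" "even N2"
    and k: "k \<in> K1 N1 N2 \<union> K2 N1 N2" and l: "l \<in> K1 N1 N2 \<union> K2 N1 N2"
  shows "(\<Sum>n<N1 * N2. fc k (grid_point N1 N2 n) * fc l (grid_point N1 N2 n)) =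
      (if k = l then real (N1 * N2) / (if k \<in> K1 N1 N2 then 1 else 2) else 0)"
    and "(\<Sum>n<N1 * N2. fs k (grid_point N1 N2 n) * fs l (grid_point N1 N2 n)) =
      (if k = l \<and> k \<notin> K1 N1 N2 then real (N1 * N2) / 2 else 0)"
    and "(\<Sum>n<N1 * N2. fs k (grid_point N1 N2 n) * fc l (grid_point N1 N2 n)) = 0"
  unfolding fc_fs_products sum_divide_distrib[symmetric] sum.distrib sum_subtractf
    sum_fc_grid[OF N(1,3)] sum_fs_grid[OF N(1,3)] fst_add snd_add fst_diff snd_diff K_cong[OF N k l]
  by auto

text \<open>Pairing the expansion with a basis function over the grid isolates its coefficient times
  \<open>N1 * N2\<close>; the factor 2 before the \<open>K2\<close> sum compensates the halved
  norms. The sine sum runs over \<open>K2\<close> only, hence the smaller range for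
  \<open>b\<close>.\<close>

lemma fourier_expansion_grid_inj:
  assumes N: "N1 > 0" "even N1" "N2 > 0" "even N2"
    and 0: "\<And>n. n < N1 * N2 \<Longrightarrow> fourier_expansion N1 N2 a b (grid_point N1 N2 n) = 0"
  shows "l \<in> K1 N1 N2 \<union> K2 N1 N2 \<Longrightarrow> a l = 0" and "l \<in> K2 N1 N2 \<Longrightarrow> b l = 0"
proof -
  let ?s = "grid_point N1 N2" and ?N = "real (N1 * N2)"
  have *: "(\<Sum>n<N1 * N2. fourier_expansion N1 N2 a b (?s n) * g (?s n)) =
      (\<Sum>k\<in>K1 N1 N2. a k * (\<Sum>n<N1 * N2. fc k (?s n) * g (?s n)))
      + 2 * (\<Sum>k\<in>K2 N1 N2. a k * (\<Sum>n<N1 * N2. fc k (?s n) * g (?s n))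
        + b k * (\<Sum>n<N1 * N2. fs k (?s n) * g (?s n)))" for g
  proof -
    have "fourier_expansion N1 N2 a b s * g s =
      (\<Sum>k\<in>K1 N1 N2. a k * (fc k s * g s))
      + 2 * (\<Sum>k\<in>K2 N1 N2. a k * (fc k s * g s) + b k * (fs k s * g s))" for s
      unfolding fourier_expansion_def distrib_right mult.assoc sum_distrib_right ..
    then show ?thesis
      by (simp add: sum.distrib sum_distrib_left sum.swap[of _ _ "{..<N1 * N2}"])
  qed
  have disj: "k \<notin> K1 N1 N2" if "k \<in> K2 N1 N2" for k using that disjoint_K[of N1 N2] by blast
  have N0: "?N \<noteq> 0" using N by simp
  show "a l = 0" if l: "l \<in> K1 N1 N2 \<union> K2 N1 N2"
  proof -
    have "0 = (\<Sum>n<N1 * N2. fourier_expansion N1 N2 a b (?s n) * fc l (?s n))" using 0 by simp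
    also have "\<dots> = (\<Sum>k\<in>K1 N1 N2. if k = l then a k * ?N else 0)
        + 2 * (\<Sum>k\<in>K2 N1 N2. if k = l then a k * ?N / 2 else 0)"
      unfolding * using l disj by (auto simp: fourier_orthogonality[OF N] intro!: sum.cong arg_cong2[of _ _ _ _ "(+)"])
    also have "\<dots> = a l * ?N" using l disj by (auto simp: finite_K)
    finally show ?thesis using N0 by simp
  qed
  show "b l = 0" if l: "l \<in> K2 N1 N2"
  proof -
    have cs: "(\<Sum>n<N1 * N2. fc k (?s n) * fs l (?s n)) = 0" if "k \<in> K1 N1 N2 \<union> K2 N1 N2" for k
      using fourier_orthogonality(3)[OF N _ that, of l] l by (simp add: mult.commute)
    have "0 = (\<Sum>n<N1 * N2. fourier_expansion N1 N2 a b (?s n) * fs l (?s n))" using 0 by simp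
    also have "\<dots> = 2 * (\<Sum>k\<in>K2 N1 N2. if k = l then b k * ?N / 2 else 0)"
      unfolding * using l disj by (auto simp: cs fourier_orthogonality[OF N] intro!: sum.cong)
    also have "\<dots> = b l * ?N" using l by (simp add: finite_K)
    finally show ?thesis using N0 by simp
  qed
qed

section \<open>The Fourier matrix as evaluation on the grid\<close>

lemma scalar_prod_vec_of_list:
  fixes xs ys :: "'a :: comm_semiring_0 list"
  shows "length xs = length ys \<Longrightarrow>
  vec_of_list xs \<bullet> vec_of_list ys = sum_list (map2 (*) xs ys)"
  by (induction xs ys rule: list_induct2) auto

lemma fourier_mat_carrier: "fourier_mat N1 N2 ks1 ks2 \<in> carrier_mat (N1 * N2) (N1 * N2)"
  by (auto simp: fourier_mat_def intro!: carrier_matI)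

text \<open>The doubled row entries over \<open>K2\<close> carry the factor 2 of the expansion, and
  distinctness of the enumerations turns list sums into set sums.\<close>

lemma fourier_mat_mult_coeff_vec:
  assumes N: "N1 > 0" "even N1" "N2 > 0" "even N2"
    and ks: "enumerates ks1 (K1 N1 N2)" "enumerates ks2 (K2 N1 N2)"
  shows "fourier_mat N1 N2 ks1 ks2 *\<^sub>v coeff_vec ks1 ks2 a b =
    grid_values N1 N2 (fourier_expansion N1 N2 a b)"
proof (rule eq_vecI)
  fix n assume "n < dim_vec (grid_values N1 N2 (fourier_expansion N1 N2 a b))"
  then have n: "n < N1 * N2" by (simp add: grid_values_def)
  define s where "s = grid_point N1 N2 n"
  let ?row = "map (\<lambda>k. fc k s) ks1 @ map (\<lambda>k. 2 * fc k s) ks2 @ map (\<lambda>k. 2 * fs k s) ks2"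
  \<comment> \<open>\<open>mat_of_rows\<close> is given the column count \<open>N1 * N2\<close>, so
    a row can be read back only if its list has that length.\<close>
  have len: "length ?row = N1 * N2" using length_enumerations[OF N ks] by simp
  have "row (fourier_mat N1 N2 ks1 ks2) n = vec_of_list ?row"
    unfolding fourier_mat_def using n len
    by (subst mat_of_rows_row) (simp_all add: Let_def s_def carrier_vecI del: vec_of_list_map)
  then have "(fourier_mat N1 N2 ks1 ks2 *\<^sub>v coeff_vec ks1 ks2 a b) $ n =
      vec_of_list ?row \<bullet> vec_of_list (map a ks1 @ map a ks2 @ map b ks2)"
    using n fourier_mat_carrier[of N1 N2 ks1 ks2] by (simp add: coeff_vec_def)
  also have "\<dots> = (\<Sum>k\<leftarrow>ks1. fc k s * a k) + (\<Sum>k\<leftarrow>ks2. 2 * fc k s * a k) + (\<Sum>k\<leftarrow>ks2. 2 * fs k s * b k)"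
    by (simp add: scalar_prod_vec_of_list zip_map_map zip_same_conv_map comp_def)
  also have "\<dots> = fourier_expansion N1 N2 a b s"
    using ks by (simp add: enumerates_def sum_list_distinct_conv_sum_set fourier_expansion_def
        sum.distrib sum_distrib_left mult_ac)
  finally show "(fourier_mat N1 N2 ks1 ks2 *\<^sub>v coeff_vec ks1 ks2 a b) $ n =
      grid_values N1 N2 (fourier_expansion N1 N2 a b) $ n"
    using n by (simp add: grid_values_def s_def)
qed (use fourier_mat_carrier[of N1 N2 ks1 ks2] in \<open>simp add: grid_values_def\<close>)

text \<open>Cutting \<open>x\<close> into three blocks determines functions on the enumerations;
  since these are disjoint, a single \<open>a\<close> serves both cosine blocks. This carries
  injectivity from expansions to arbitrary vectors.\<close>

lemma coeff_vec_surj: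
  assumes "distinct ks1" "distinct ks2" "set ks1 \<inter> set ks2 = {}"
    and x: "x \<in> carrier_vec (length ks1 + 2 * length ks2)"
  obtains a b where "x = coeff_vec ks1 ks2 a b"
proof -
  have ex: "\<exists>f. map f ks = ys" if "distinct ks" "length ks = length ys" for ks :: "wavenumber list" and ys :: "real list"
  proof
    \<comment> \<open>The value is unspecified off \<open>ks\<close>, where \<open>map\<close> never
      looks.\<close>
    show "map (\<lambda>k. the (map_of (zip ks ys) k)) ks = ys"
      using that by (intro nth_equalityI) (auto simp: map_of_zip_nth)
  qed
  define p q where "p = length ks1" and "q = length ks2"
  have len: "length (list_of_vec x) = p + 2 * q" using x p_def q_def by auto
  obtain a1 where a1: "map a1 ks1 = take p (list_of_vec x)"
    using ex[OF assms(1), of "take p (list_of_vec x)"] len p_def by auto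
  obtain a2 where a2: "map a2 ks2 = take q (drop p (list_of_vec x))"
    using ex[OF assms(2), of "take q (drop p (list_of_vec x))"] len q_def by auto
  obtain b where b: "map b ks2 = drop (p + q) (list_of_vec x)"
    using ex[OF assms(2), of "drop (p + q) (list_of_vec x)"] len q_def by auto
  define a where "a k = (if k \<in> set ks1 then a1 k else a2 k)" for k
  have "map a ks1 = map a1 ks1" by (simp add: a_def)
  moreover have "map a ks2 = map a2 ks2" using assms(3) by (auto simp: a_def)
  ultimately have "map a ks1 @ map a ks2 @ map b ks2 = list_of_vec x"
    unfolding a1 a2 b by (metis a1 a2 b append_take_drop_id drop_drop add.commute)
  then have "x = coeff_vec ks1 ks2 a b" unfolding coeff_vec_def by (simp add: vec_list)
  then show ?thesis by (rule that)
qed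

text \<open>A kernel vector is the coefficient vector of an expansion that vanishes at every grid
  point.\<close>

lemma fourier_mat_inj:
  assumes N: "N1 > 0" "even N1" "N2 > 0" "even N2"
    and ks: "enumerates ks1 (K1 N1 N2)" "enumerates ks2 (K2 N1 N2)"
    and x: "x \<in> carrier_vec (N1 * N2)" and 0: "fourier_mat N1 N2 ks1 ks2 *\<^sub>v x = 0\<^sub>v (N1 * N2)"
  shows "x = 0\<^sub>v (N1 * N2)"
proof -
  have len: "length ks1 + 2 * length ks2 = N1 * N2" by (rule length_enumerations[OF N ks])
  obtain a b where ab: "x = coeff_vec ks1 ks2 a b"
    using coeff_vec_surj[of ks1 ks2 x] ks disjoint_K[of N1 N2] x len by (auto simp: enumerates_def)
  have "fourier_expansion N1 N2 a b (grid_point N1 N2 n) = 0" if "n < N1 * N2" for n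
    using arg_cong[OF 0, of "\<lambda>x. x $ n"] that
    unfolding ab fourier_mat_mult_coeff_vec[OF N ks] by (simp add: grid_values_def)
  from fourier_expansion_grid_inj[OF N this]
  have "map a ks1 = map (\<lambda>_. 0) ks1" "map a ks2 = map (\<lambda>_. 0) ks2" "map b ks2 = map (\<lambda>_. 0) ks2"
    using ks by (auto simp: enumerates_def)
  then have "x = vec_of_list (replicate (N1 * N2) 0)"
    unfolding ab coeff_vec_def len[symmetric] by (simp add: map_replicate_const replicate_add mult_2)
  then show ?thesis by (auto simp: vec_of_list_index)
qed

section \<open>The flipped process\<close>

lemma flip_mat_carrier: "flip_mat N1 N2 \<in> carrier_mat (2 * N1 * (2 * N2)) (N1 * N2)"
  by (auto simp: flip_mat_def kronecker_def append_rows_def mirror_mat_def algebra_simps intro!: carrier_matI)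

text \<open>The original image is the corner block of the flipped one: the point in column
  \<open>j mod N1\<close> and row \<open>j div N1\<close> keeps its position, but the enumeration
  now has \<open>2 * N1\<close> points per row.\<close>

lemma flip_mat_mult_vec_index:
  assumes x: "x \<in> carrier_vec (N1 * N2)" and j: "j < N1 * N2"
  shows "(flip_mat N1 N2 *\<^sub>v x) $ ((j div N1) * (2 * N1) + j mod N1) = x $ j"
proof -
  define i where "i = (j div N1) * (2 * N1) + j mod N1"
  have N1: "N1 > 0" using j by (cases N1) auto
  have j2: "j div N1 < N2" using j by (simp add: less_mult_imp_div_less mult.commute)
  have j1: "j mod N1 < N1" using N1 by simp
  have j1': "j mod N1 < 2 * N1" using j1 by linarith
  \<comment> \<open>The row count of the stacked factor unfolds to \<open>N1 + N1\<close>, hence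
    this form of the divisor.\<close>
  have i_div: "i div (N1 + N1) = j div N1" and i_mod: "i mod (N1 + N1) = j mod N1"
    using j1' N1 by (simp_all add: i_def mult_2[symmetric] del: mod_less_divisor)
  have "i < (j div N1) * (2 * N1) + 2 * N1" using j1 by (simp add: i_def)
  also have "\<dots> = Suc (j div N1) * (2 * N1)" by simp
  also have "\<dots> \<le> N2 * (2 * N1)" using j2 by (intro mult_right_mono) auto
  also have "\<dots> \<le> (N2 + N2) * (N1 + N1)" by (simp add: algebra_simps)
  finally have i: "i < (N2 + N2) * (N1 + N1)" .
  \<comment> \<open>Quotient and remainder of \<open>i\<close> fall into the identity halves of both
    Kronecker factors, so row \<open>i\<close> is the unit vector at \<open>j\<close>.\<close>
  have entry: "flip_mat N1 N2 $$ (i, k) = (if k = j then 1 else 0)" if k: "k < N1 * N2" for k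
  proof -
    have "k div N1 < N2" using k by (simp add: less_mult_imp_div_less mult.commute)
    moreover have "k = j \<longleftrightarrow> k div N1 = j div N1 \<and> k mod N1 = j mod N1"
      by (metis div_mult_mod_eq)
    ultimately show ?thesis
      using k i j1 j2 N1 unfolding flip_mat_def kronecker_def
      by (auto simp: append_rows_def mirror_mat_def i_div i_mod mult.commute)
  qed
  have "i < dim_row (flip_mat N1 N2)" "dim_col (flip_mat N1 N2) = N1 * N2"
    using i carrier_matD[OF flip_mat_carrier[of N1 N2]] by (simp_all add: algebra_simps)
  then have "(flip_mat N1 N2 *\<^sub>v x) $ i = (\<Sum>k<N1 * N2. flip_mat N1 N2 $$ (i, k) * x $ k)"
    using x
    by (auto simp: scalar_prod_def lessThan_atLeast0 intro!: sum.cong)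
  also have "\<dots> = (\<Sum>k<N1 * N2. if k = j then x $ k else 0)"
    using entry by (intro sum.cong) auto
  finally show ?thesis using j by (simp add: i_def)
qed

lemma flip_mat_inj:
  assumes x: "x \<in> carrier_vec (N1 * N2)" and 0: "flip_mat N1 N2 *\<^sub>v x = 0\<^sub>v (2 * N1 * (2 * N2))"
  shows "x = 0\<^sub>v (N1 * N2)"
proof (rule eq_vecI)
  fix j assume "j < dim_vec (0\<^sub>v (N1 * N2) :: real Matrix.vec)"
  then have j: "j < N1 * N2" by simp
  then have N1: "N1 > 0" by (cases N1) auto
  have "(j div N1) * (2 * N1) + j mod N1 < Suc (j div N1) * (2 * N1)"
    using mod_less_divisor[OF N1, of j] by (simp del: mod_less_divisor)
  also have "\<dots> \<le> N2 * (2 * N1)" using j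
    by (intro mult_right_mono) (auto simp: Suc_le_eq less_mult_imp_div_less mult.commute)
  also have "\<dots> \<le> 2 * N1 * (2 * N2)" by simp
  finally show "x $ j = 0\<^sub>v (N1 * N2) $ j"
    using flip_mat_mult_vec_index[OF x j] j unfolding 0 by simp
qed (use x in simp)

section \<open>Componentwise derivatives of vector functions\<close>

lemma vec_has_deriv_cong:
  assumes "t \<in> T" "\<And>\<tau>. \<tau> \<in> T \<Longrightarrow> x \<tau> = y \<tau>" "vec_has_deriv x d t T"
  shows "vec_has_deriv y d t T"
  unfolding vec_has_deriv_def
proof (intro conjI ballI allI impI)
  fix i assume "i < dim_vec d"
  then have "((\<lambda>\<tau>. x \<tau> $ i) has_real_derivative d $ i) (at t within T)"
    using assms(3) by (simp add: vec_has_deriv_def)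
  then show "((\<lambda>\<tau>. y \<tau> $ i) has_real_derivative d $ i) (at t within T)"
    \<comment> \<open>The radius 1 is arbitrary, since the two functions agree on all of
      \<open>T\<close>.\<close>
    by (rule has_field_derivative_transform_within[where d = 1]) (use assms in auto)
qed (use assms in \<open>auto simp: vec_has_deriv_def\<close>)

text \<open>Each component is a finite linear combination with constant coefficients. The dimension
  of \<open>x\<close> is known on \<open>T\<close> only, so the sum formula is transferred within
  \<open>T\<close>.\<close>

lemma vec_has_deriv_mult_mat_vec:
  assumes A: "A \<in> carrier_mat m n" and d: "d \<in> carrier_vec n" and t: "t \<in> T"
    and x: "vec_has_deriv x d t T"
  shows "vec_has_deriv (\<lambda>\<tau>. A *\<^sub>v x \<tau>) (A *\<^sub>v d) t T"
  unfolding vec_has_deriv_def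
proof (intro conjI ballI allI impI)
  fix i assume "i < dim_vec (A *\<^sub>v d)"
  then have i: "i < m" using A by simp
  have eq: "(A *\<^sub>v y) $ i = (\<Sum>j<n. A $$ (i, j) * y $ j)" if "dim_vec y = n" for y
    using i A that by (auto simp: scalar_prod_def lessThan_atLeast0 intro!: sum.cong)
  have "((\<lambda>\<tau>. \<Sum>j<n. A $$ (i, j) * x \<tau> $ j) has_real_derivative (\<Sum>j<n. A $$ (i, j) * d $ j)) (at t within T)"
    using x d by (intro DERIV_sum DERIV_cmult) (auto simp: vec_has_deriv_def)
  then have "((\<lambda>\<tau>. (A *\<^sub>v x \<tau>) $ i) has_real_derivative (\<Sum>j<n. A $$ (i, j) * d $ j)) (at t within T)"
    by (rule has_field_derivative_transform_within[where d = 1])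
      (use x d t in \<open>auto simp: vec_has_deriv_def eq\<close>)
  then show "((\<lambda>\<tau>. (A *\<^sub>v x \<tau>) $ i) has_real_derivative (A *\<^sub>v d) $ i) (at t within T)"
    using d by (simp add: eq)
qed (use A in auto)

text \<open>Needed because the expansion of the process is assumed on the unit square only.\<close>

lemma grid_point_in_unit_square:
  assumes "n < N1 * N2"
  shows "grid_point N1 N2 n \<in> cbox 0 1"
proof -
  have "N1 > 0" using assms by (cases N1) auto
  moreover have "n div N1 < N2" using assms by (simp add: less_mult_imp_div_less mult.commute)
  ultimately show ?thesis
    by (auto simp: grid_point_def mem_box_cart forall_2 divide_le_eq less_imp_le)
qed

section \<open>The evolution equation of the flipped coefficients\<close>

theorem proposition1:
  fixes N1 N2 :: nat and T :: "real set"
    and v :: "real^2 \<Rightarrow> real \<Rightarrow> real^2"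
    and D :: "real^2 \<Rightarrow> real \<Rightarrow> real^2^2"
    and \<xi> Q \<xi>s :: "real^2 \<Rightarrow> real \<Rightarrow> real"
    and ac as bc bs :: "wavenumber \<Rightarrow> real \<Rightarrow> real"
    and ks1 ks2 ks1s ks2s :: "wavenumber list"
    and \<alpha> \<beta> \<alpha>s \<beta>s :: "real \<Rightarrow> real vec"
    and P :: "real \<Rightarrow> real mat"
    and F Fs R H :: "real mat"
  assumes "N1 > 0" "even N1" "N2 > 0" "even N2"
    and "is_interval T" "interior T \<noteq> {}"
    and "enumerates ks1 (K1 N1 N2)" "enumerates ks2 (K2 N1 N2)"
    and "enumerates ks1s (K1 (2 * N1) (2 * N2))" "enumerates ks2s (K2 (2 * N1) (2 * N2))"
    and "\<And>t. t \<in> T \<Longrightarrow> regular_fields N1 N2 (\<lambda>s. v s t) (\<lambda>s. D s t)"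
    and "\<And>s t. s \<in> cbox 0 1 \<Longrightarrow> t \<in> T \<Longrightarrow>
           \<xi> s t = fourier_expansion N1 N2 (\<lambda>k. ac k t) (\<lambda>k. as k t) s"
    and "\<And>s t. s \<in> cbox 0 1 \<Longrightarrow> t \<in> T \<Longrightarrow>
           Q s t = fourier_expansion N1 N2 (\<lambda>k. bc k t) (\<lambda>k. bs k t) s"
    and "\<And>t. \<alpha> t = coeff_vec ks1 ks2 (\<lambda>k. ac k t) (\<lambda>k. as k t)"
    and "\<And>t. \<beta> t = coeff_vec ks1 ks2 (\<lambda>k. bc k t) (\<lambda>k. bs k t)"
    and "\<And>t. P t = galerkin_mat (\<lambda>s. v s t) (\<lambda>s. D s t) ks1 ks2"
    and "\<And>t. t \<in> T \<Longrightarrow> vec_has_deriv \<alpha> (P t *\<^sub>v \<alpha> t + \<beta> t) t T"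
    and "F = fourier_mat N1 N2 ks1 ks2"
    and "Fs = fourier_mat (2 * N1) (2 * N2) ks1s ks2s"
    and "R = flip_mat N1 N2"
    and "\<And>t. t \<in> T \<Longrightarrow>
           grid_values (2 * N1) (2 * N2) (\<lambda>s. \<xi>s s t) = R *\<^sub>v grid_values N1 N2 (\<lambda>s. \<xi> s t)"
    and "\<And>t. \<alpha>s t = mp_inverse Fs *\<^sub>v grid_values (2 * N1) (2 * N2) (\<lambda>s. \<xi>s s t)"
    and "H = mp_inverse Fs * R * F"
    and "\<And>t. \<beta>s t = H *\<^sub>v \<beta> t"
  shows "\<forall>t\<in>T. vec_has_deriv \<alpha>s (H * P t * mp_inverse H *\<^sub>v \<alpha>s t + \<beta>s t) t T"
proof
  note N = assms(1-4) and ks = assms(7,8) and kss = assms(9,10) and \<xi> = assms(12) and \<alpha> = assms(14)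
    and P = assms(16) and ode = assms(17) and F = assms(18) and Fs = assms(19) and R = assms(20)
    and \<xi>s = assms(21) and \<alpha>s = assms(22) and H = assms(23) and \<beta>s = assms(24)
  fix t assume t: "t \<in> T"
  define n m where "n = N1 * N2" and "m = 2 * N1 * (2 * N2)"
  have Ns: "2 * N1 > 0" "even (2 * N1)" "2 * N2 > 0" "even (2 * N2)" using N by auto
  have Fc: "F \<in> carrier_mat n n" and Fsc: "Fs \<in> carrier_mat m m" and Rc: "R \<in> carrier_mat m n"
    unfolding F Fs R n_def m_def by (rule fourier_mat_carrier flip_mat_carrier)+
  have F_inj: "x = 0\<^sub>v n" if "x \<in> carrier_vec n" "F *\<^sub>v x = 0\<^sub>v n" for x
    using fourier_mat_inj[OF N ks] that unfolding F n_def by blast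
  have Fs_inj: "x = 0\<^sub>v m" if "x \<in> carrier_vec m" "Fs *\<^sub>v x = 0\<^sub>v m" for x
    using fourier_mat_inj[OF Ns kss] that unfolding Fs m_def by blast
  have R_inj: "x = 0\<^sub>v n" if "x \<in> carrier_vec n" "R *\<^sub>v x = 0\<^sub>v m" for x
    using flip_mat_inj that unfolding R n_def m_def by blast
  define M where "M = mp_inverse Fs"
  have M: "M \<in> carrier_mat m m" "M * Fs = 1\<^sub>m m"
    unfolding M_def by (rule mp_inverse_full_col_rank[OF Fsc Fs_inj]; assumption)+
  \<comment> \<open>\<open>Fs\<close> is square, so its left inverse is two-sided; multiplying by
    \<open>Fs\<close> therefore strips \<open>M\<close> off \<open>H\<close> in the injectivity
    argument below.\<close>
  have FsM: "Fs * M = 1\<^sub>m m" by (rule mat_mult_left_right_inverse[OF M(1) Fsc M(2)])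
  have Hc: "H \<in> carrier_mat m n" using M Rc Fc unfolding H M_def[symmetric] by auto
  have Hx: "H *\<^sub>v x = M *\<^sub>v (R *\<^sub>v (F *\<^sub>v x))" if "x \<in> carrier_vec n" for x
    using that M(1) Rc Fc unfolding H M_def[symmetric]
    by (simp add: assoc_mult_mat_vec[of "M * R" m n F n] assoc_mult_mat_vec[of M m m R n] del: assoc_mult_mat)
  have H_inj: "x = 0\<^sub>v n" if x: "x \<in> carrier_vec n" and 0: "H *\<^sub>v x = 0\<^sub>v m" for x
  proof -
    have Fx: "F *\<^sub>v x \<in> carrier_vec n" and RFx: "R *\<^sub>v (F *\<^sub>v x) \<in> carrier_vec m"
      using x Fc Rc by auto
    have "R *\<^sub>v (F *\<^sub>v x) = (Fs * M) *\<^sub>v (R *\<^sub>v (F *\<^sub>v x))" using RFx FsM by simp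
    also have "\<dots> = Fs *\<^sub>v (H *\<^sub>v x)" using assoc_mult_mat_vec[OF Fsc M(1) RFx] Hx[OF x] by simp
    also have "\<dots> = 0\<^sub>v m" using 0 Fsc by auto
    finally show ?thesis using F_inj[OF x] R_inj[OF Fx] by blast
  qed
  have Hp: "mp_inverse H \<in> carrier_mat n m" "mp_inverse H * H = 1\<^sub>m n"
    by (rule mp_inverse_full_col_rank[OF Hc H_inj]; assumption)+
  have len: "length ks1 + 2 * length ks2 = n" unfolding n_def by (rule length_enumerations[OF N ks])
  have Pc: "P t \<in> carrier_mat n n" using galerkin_mat_carrier[of _ _ ks1 ks2] unfolding P len .
  have \<alpha>c: "\<alpha> \<tau> \<in> carrier_vec n" and \<beta>c: "\<beta> \<tau> \<in> carrier_vec n" for \<tau>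
    unfolding carrier_vec_def mem_Collect_eq \<alpha> assms(15) coeff_vec_def dim_vec_of_list length_append length_map
    using len by linarith+
  \<comment> \<open>On the grid the process is \<open>F\<close> applied to its coefficients, so
    flipping and transforming back amounts to applying \<open>H\<close>.\<close>
  have \<alpha>s_eq: "\<alpha>s \<tau> = H *\<^sub>v \<alpha> \<tau>" if \<tau>: "\<tau> \<in> T" for \<tau>
  proof -
    have "grid_values N1 N2 (\<lambda>s. \<xi> s \<tau>) = F *\<^sub>v \<alpha> \<tau>"
      unfolding F \<alpha> fourier_mat_mult_coeff_vec[OF N ks]
      using \<xi>[OF grid_point_in_unit_square \<tau>] by (auto simp: grid_values_def)
    then show ?thesis unfolding \<alpha>s \<xi>s[OF \<tau>] Hx[OF \<alpha>c] M_def by simp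
  qed
  have P\<alpha>: "P t *\<^sub>v \<alpha> t \<in> carrier_vec n" using Pc \<alpha>c by auto
  \<comment> \<open>Since \<open>\<alpha>s t\<close> lies in the range of \<open>H\<close>,
    regrouping brings \<open>mp_inverse H\<close> next to \<open>H\<close>; the product in the other
    order is only a projection.\<close>
  have "H * P t * mp_inverse H *\<^sub>v \<alpha>s t = H * P t *\<^sub>v ((mp_inverse H * H) *\<^sub>v \<alpha> t)"
    unfolding \<alpha>s_eq[OF t] using Hc Pc Hp(1) \<alpha>c[of t]
    by (simp add: assoc_mult_mat_vec[of _ m n _ m] assoc_mult_mat_vec[of _ n m _ n] del: assoc_mult_mat)
  also have "\<dots> = H *\<^sub>v (P t *\<^sub>v \<alpha> t)"
    using Hc Pc \<alpha>c[of t] by (simp add: Hp(2) assoc_mult_mat_vec[of _ m n _ n])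
  finally have "H * P t * mp_inverse H *\<^sub>v \<alpha>s t + \<beta>s t = H *\<^sub>v (P t *\<^sub>v \<alpha> t + \<beta> t)"
    unfolding \<beta>s using mult_add_distrib_mat_vec[OF Hc P\<alpha> \<beta>c] by simp
  moreover have "vec_has_deriv (\<lambda>\<tau>. H *\<^sub>v \<alpha> \<tau>) (H *\<^sub>v (P t *\<^sub>v \<alpha> t + \<beta> t)) t T"
    by (rule vec_has_deriv_mult_mat_vec[OF Hc _ t ode[OF t]]) (use P\<alpha> \<beta>c in auto)
  \<comment> \<open>The derivative is taken within \<open>T\<close>, so agreement of
    \<open>\<alpha>s\<close> with the transformed coefficients on \<open>T\<close> suffices.\<close>
  ultimately show "vec_has_deriv \<alpha>s (H * P t * mp_inverse H *\<^sub>v \<alpha>s t + \<beta>s t) t T"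
    using vec_has_deriv_cong[OF t, of "\<lambda>\<tau>. H *\<^sub>v \<alpha> \<tau>" \<alpha>s] \<alpha>s_eq by simp
qed

end
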